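(* Let $0<\beta<\alpha<\pi$ be such that $2\beta+\alpha<\pi$, and let $$\mu=\sin\Big(\frac{\alpha}{2}-\frac{\beta}{4}\Big)\cos\Big(\frac{\alpha}{2}+\frac{5}{8}\beta\Big).$$ Let $\lambda>\mu+2$ be any fixed positive number. Assume that $$mK\le\frac{\beta}{4(\lambda+\mu+2)\ln\big(\frac{\lambda+2\mu+2}{\mu}\big)}\qquad\text{and}\qquad D(\Omega)=0.$$ Then the solution $\Theta(t)=(\theta_1(t),\dots,\theta_N(t))$, $t\ge0$, of $$m\ddot\theta_i+\dot\theta_i=\omega_i+\frac{K}{N}\sum_{j=1}^N\sin(\theta_j-\theta_i),\qquad t>0,\ i=1,\dots,N,$$ with initial conditions satisfying $$D(\Theta(0))\le\pi-\alpha-\beta\qquad\text{and}\qquad D(\dot\Theta(0))<\lambda K$$ achieves the complete phase synchronization asymptotically, i.e. $$\lim_{t\to\infty}\big(\theta_i(t)-\theta_j(t)\big)=0\quad\text{for all }1\le i,j\le N.$$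
   Context: $N$ is a positive integer (the number of oscillators), $m>0$ is the inertia, $K>0$ is the coupling strength, and $\Omega=(\omega_1,\dots,\omega_N)\in\mathbb{R}^N$ is the constant vector of natural frequencies. The phases $\theta_i(t)$ are real-valued (not reduced modulo $2\pi$), and $\dot\Theta(t)=(\dot\theta_1(t),\dots,\dot\theta_N(t))$. For a finite-dimensional vector $X=(x_1,\dots,x_n)$, $D(X):=\max_{1\le i,j\le n}(x_i-x_j)$. *)

theory Defs
  imports "HOL-Analysis.Analysis"
begin

text \<open>The oscillators are indexed by a finite type \<open>'n\<close>, so \<open>N = CARD('n) \<ge> 1\<close>.\<close>

definition spread :: "real ^ 'n \<Rightarrow> real" where
  "spread X = Max {X $ i - X $ j | i j. True}"

text \<open>
  A classical solution on \<open>[0, \<infinity>)\<close> of the second-order Kuramoto system: \<open>\<Theta>\<close> is the phase vector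
  and \<open>V\<close> its velocity, one-sided at \<open>t = 0\<close>. The velocity is continuous up to \<open>t = 0\<close>, which ties
  the initial velocity to the equation, and the equation itself is required for \<open>t > 0\<close> only.
  Values at negative times are irrelevant.
\<close>

definition inertial_kuramoto_solution ::
  "real \<Rightarrow> real \<Rightarrow> real ^ 'n \<Rightarrow> (real \<Rightarrow> real ^ 'n) \<Rightarrow> (real \<Rightarrow> real ^ 'n) \<Rightarrow> bool" where
  "inertial_kuramoto_solution m K \<Omega> \<Theta> V \<longleftrightarrow>
     (\<forall>t\<ge>0. (\<Theta> has_vector_derivative V t) (at t within {0..})) \<and>
     continuous_on {0..} V \<and>
     (\<forall>t>0. \<exists>A. (V has_vector_derivative A) (at t) \<and>
        (\<forall>i. m * A $ i + V t $ i =
           \<Omega> $ i + K / real CARD('n) * (\<Sum>j\<in>UNIV. sin (\<Theta> t $ j - \<Theta> t $ i))))"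

end

theory Submission
  imports Defs
begin

text \<open>
  Since \<open>m v\<^sub>i' + v\<^sub>i\<close> is the coupling force, \<open>y\<^sub>i = \<theta>\<^sub>i + m v\<^sub>i\<close> obeys a first-order equation.
  Velocity differences never leave \<open>(-\<lambda>K, \<lambda>K)\<close>, so \<open>y\<close> is a perturbation of \<open>\<theta>\<close> of size at most
  \<open>m\<lambda>K \<le> \<beta>/4\<close> in differences, and a pair extremal for \<open>y\<close> is nearly extremal for \<open>\<theta>\<close>. Hence the
  diameter of \<open>y\<close> cannot reach \<open>\<pi> - \<alpha> - \<beta> + m\<lambda>K\<close>, which confines the phase differences to
  \<open>(-(\<pi> - \<alpha>), \<pi> - \<alpha>)\<close>. There, with \<open>u = \<theta>\<^sub>i - \<theta>\<^sub>j\<close> and \<open>w = v\<^sub>i - v\<^sub>j\<close>, the function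
  \<open>F = \<Sum>\<^sub>i\<^sub>j m\<^sup>2w\<^sup>2 + muw + u\<^sup>2/2 + 2mK(1 - cos u)\<close> satisfies \<open>F' = -\<Sum>\<^sub>i\<^sub>j mw\<^sup>2 + Ku sin u \<le> -\<kappa>F\<close>
  and dominates \<open>\<Sum>\<^sub>i\<^sub>j u\<^sup>2/4\<close>, so the phase differences decay exponentially.
\<close>

section \<open>A barrier principle for finitely many functions\<close>

text \<open>At the first time some member reaches \<open>c\<close>, all the others are still at most
  \<open>c\<close>, so \<open>inward\<close> applies; a negative derivative there would put that
  member above \<open>c\<close> slightly earlier. Letting \<open>inward\<close> assume the bound for
  the whole family is what allows arguments about an extremal pair.\<close>

lemma barrier_finite_family:
  fixes x :: "'a::finite \<Rightarrow> real \<Rightarrow> real"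
  assumes cont: "\<And>p. continuous_on {0..} (x p)"
    and init: "\<And>p. x p 0 < c"
    and inward: "\<And>p t. t > 0 \<Longrightarrow> (\<And>q. x q t \<le> c) \<Longrightarrow> x p t = c
      \<Longrightarrow> \<exists>d<0. (x p has_real_derivative d) (at t)"
    and "t \<ge> 0"
  shows "x p t < c"
proof (rule ccontr)
  assume neg: "\<not> x p t < c"
  \<comment> \<open>Finiteness of the index type makes this union of closed sets closed, so a first
    hitting time exists.\<close>
  define S where "S = (\<Union>p. {t \<in> {0..}. c \<le> x p t})"
  have "closed S"
    unfolding S_def
    by (intro closed_UN finite continuous_on_closed_Collect_le continuous_on_const cont closed_atLeast ballI)
  moreover have "t \<in> S" using neg \<open>t \<ge> 0\<close> by (auto simp: S_def intro!: exI[of _ p])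
  moreover have bdd: "bdd_below S" by (rule bdd_belowI[of _ 0]) (auto simp: S_def)
  ultimately have "Inf S \<in> S" by (intro closed_contains_Inf) auto
  define T where "T = Inf S"
  obtain q where q: "c \<le> x q T" and "T \<ge> 0" using \<open>Inf S \<in> S\<close> by (auto simp: S_def T_def)
  have "T \<noteq> 0" using init[of q] q by auto
  then have "T > 0" using \<open>T \<ge> 0\<close> by simp
  have before: "x r s < c" if "0 \<le> s" "s < T" for r s
  proof (rule ccontr)
    assume "\<not> x r s < c"
    then have "s \<in> S" using that by (auto simp: S_def intro!: exI[of _ r])
    then show False using cInf_lower[OF _ bdd, of s] that by (simp add: T_def)
  qed
  \<comment> \<open>A value above \<open>c\<close> at \<open>T\<close> would force a crossing of
    \<open>c\<close> by the intermediate value theorem, and a crossing before \<open>T\<close> is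
    excluded.\<close>
  have le: "x r T \<le> c" for r
  proof (rule ccontr)
    assume "\<not> x r T \<le> c"
    moreover have "continuous_on {0..T} (x r)"
      using cont by (rule continuous_on_subset) auto
    ultimately obtain s where s: "0 \<le> s" "s \<le> T" "x r s = c"
      using IVT'[of "x r" 0 c T] init[of r] \<open>T \<ge> 0\<close> by (auto simp: less_imp_le)
    then have "s = T" using before[of s r] by fastforce
    then show False using s \<open>\<not> x r T \<le> c\<close> by simp
  qed
  obtain d where "d < 0" "(x q has_real_derivative d) (at T)"
    using inward[OF \<open>T > 0\<close> le, of q] le[of q] q by force
  then obtain e where e: "e > 0" "\<forall>h>0. h < e \<longrightarrow> x q T < x q (T - h)"
    using DERIV_neg_dec_left by blast
  \<comment> \<open>The bound \<open>T / 2\<close> keeps \<open>T - h\<close> positive, so that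
    \<open>before\<close> applies there.\<close>
  define h where "h = min (e / 2) (T / 2)"
  have "h > 0" "h < e" "h < T" using e \<open>T > 0\<close> by (auto simp: h_def min_def)
  then have "x q T < x q (T - h)" using e by blast
  moreover have "x q (T - h) < c" using \<open>h > 0\<close> \<open>h < T\<close> by (intro before) auto
  ultimately show False using q by simp
qed

section \<open>Trigonometric bounds and the spread\<close>

text \<open>The double-angle formula and \<open>x * cos x \<le> sin x\<close> at half the angle give
  the factor \<open>cos\<^sup>2 (u / 2)\<close>, which is smallest at
  \<open>\<bar>u\<bar> = B\<close>. For \<open>B < pi\<close> the constant is positive, which makes
  the dissipation coercive in the phases.\<close>

lemma mult_sin_ge_square:
  fixes u B :: real
  assumes "\<bar>u\<bar> \<le> B" "B \<le> pi"
  shows "(cos (B / 2))\<^sup>2 * u\<^sup>2 \<le> u * sin u"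
proof -
  have half: "x * cos x \<le> sin x" if "0 \<le> x" "x \<le> pi / 2" for x :: real
  proof -
    have "(\<lambda>x. x * cos x - sin x) x \<le> (\<lambda>x. x * cos x - sin x) 0"
    proof (rule DERIV_nonpos_imp_nonincreasing[OF that(1)])
      fix y :: real assume y: "0 \<le> y" "y \<le> x"
      have "((\<lambda>x. x * cos x - sin x) has_real_derivative - (y * sin y)) (at y)"
        by (auto intro!: derivative_eq_intros)
      moreover have "0 \<le> sin y" using y that by (intro sin_ge_zero) auto
      ultimately show "\<exists>z. ((\<lambda>x. x * cos x - sin x) has_real_derivative z) (at y) \<and> z \<le> 0"
        using y(1) by (intro exI[of _ "- (y * sin y)"]) auto
    qed
    then show ?thesis by simp
  qed
  define x where "x = \<bar>u\<bar>"
  have x: "0 \<le> x" "x \<le> B" using assms by (auto simp: x_def)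
  have cos: "0 \<le> cos (B / 2)" "cos (B / 2) \<le> cos (x / 2)"
    using x assms(2) by (auto intro!: cos_ge_zero cos_monotone_0_pi_le)
  have "(cos (B / 2))\<^sup>2 * x\<^sup>2 \<le> (cos (x / 2))\<^sup>2 * x\<^sup>2"
    using cos by (intro mult_right_mono power_mono) auto
  also have "\<dots> = x * (2 * (x / 2 * cos (x / 2)) * cos (x / 2))"
    by (simp add: power2_eq_square)
  also have "\<dots> \<le> x * (2 * sin (x / 2) * cos (x / 2))"
    using x assms(2) cos half[of "x / 2"] by (intro mult_left_mono mult_right_mono) auto
  also have "\<dots> = x * sin x" using sin_double[of "x / 2"] by simp
  \<comment> \<open>Both sides are even in \<open>u\<close>.\<close>
  finally show ?thesis by (cases "u \<ge> 0") (auto simp: x_def)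
qed

lemma one_minus_cos_le:
  fixes u :: real
  shows "1 - cos u \<le> u\<^sup>2 / 2"
proof -
  have "(sin (u / 2))\<^sup>2 \<le> (u / 2)\<^sup>2"
    using abs_sin_x_le_abs_x[of "u / 2"] by (simp only: abs_le_square_iff)
  moreover have "cos u = 1 - 2 * (sin (u / 2))\<^sup>2" using cos_double_sin[of "u / 2"] by simp
  ultimately show ?thesis by (simp add: power_divide)
qed

lemma spread_ge: "X $ i - X $ j \<le> spread X"
proof -
  have "{X $ i - X $ j | i j. True} = range (\<lambda>(i, j). X $ i - X $ j)" by auto
  then have "finite {X $ i - X $ j | i j. True}" by simp
  then show ?thesis unfolding spread_def by (intro Max_ge) auto
qed

section \<open>The system in scalar form with a common frequency\<close>

text \<open>The single \<open>\<omega>\<close> encodes identical natural frequencies and cancels in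
  every difference. Two-sided derivatives are available for \<open>t > 0\<close> only; continuity on
  \<open>{0..}\<close> carries the estimates down to the initial time.\<close>

locale identical_inertial_oscillators =
  fixes m K \<omega> :: real and \<theta> v :: "'n::finite \<Rightarrow> real \<Rightarrow> real"
  assumes m_pos: "m > 0" and K_pos: "K > 0"
    and continuous_phase: "continuous_on {0..} (\<theta> i)"
    and continuous_velocity: "continuous_on {0..} (v i)"
    and deriv_phase: "t > 0 \<Longrightarrow> (\<theta> i has_real_derivative v i t) (at t)"
    and deriv_velocity: "t > 0 \<Longrightarrow> (v i has_real_derivative
      (\<omega> + K / real CARD('n) * (\<Sum>k\<in>UNIV. sin (\<theta> k t - \<theta> i t)) - v i t) / m) (at t)"
begin

definition force :: "real \<Rightarrow> 'n \<Rightarrow> real" where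
  "force t i = (\<Sum>k\<in>UNIV. sin (\<theta> k t - \<theta> i t)) / real CARD('n)"

lemma deriv_velocity_force:
  "t > 0 \<Longrightarrow> (v i has_real_derivative (\<omega> + K * force t i - v i t) / m) (at t)"
  using deriv_velocity[of t i] by (simp add: force_def)

lemma abs_force_le: "\<bar>force t i\<bar> \<le> 1"
proof -
  have "\<bar>\<Sum>k\<in>UNIV. sin (\<theta> k t - \<theta> i t)\<bar> \<le> (\<Sum>k\<in>(UNIV::'n set). 1)"
    by (rule order_trans[OF sum_abs sum_mono]) auto
  then show ?thesis by (simp add: force_def field_simps)
qed

section \<open>A priori bound on velocity differences\<close>

text \<open>Forces differ by at most 2, so at the level \<open>l * K\<close> with
  \<open>l > 2\<close> the damping outweighs the coupling and the difference decreases. Ranging over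
  ordered pairs makes the one-sided bound two-sided.\<close>

lemma velocity_difference_bound:
  assumes "l > 2" "\<And>i j. v i 0 - v j 0 < l * K" "t \<ge> 0"
  shows "v i t - v j t < l * K"
proof -
  define x where "x = (\<lambda>(i, j) t. v i t - v j t)"
  have "x (i, j) t < l * K"
  proof (rule barrier_finite_family[OF _ _ _ \<open>t \<ge> 0\<close>])
    fix p show "continuous_on {0..} (x p)"
      by (cases p) (auto simp: x_def intro!: continuous_intros continuous_velocity)
    show "x p 0 < l * K" using assms(2) by (cases p) (simp add: x_def)
    fix t :: real assume "t > 0" and eq: "x p t = l * K"
    obtain a b where p: "p = (a, b)" by (cases p)
    have "(x p has_real_derivative
        (\<omega> + K * force t a - v a t) / m - (\<omega> + K * force t b - v b t) / m) (at t)"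
      unfolding x_def p prod.case by (intro DERIV_diff deriv_velocity_force \<open>t > 0\<close>)
    also have "(\<omega> + K * force t a - v a t) / m - (\<omega> + K * force t b - v b t) / m
        = (K * (force t a - force t b) - l * K) / m"
      using eq by (simp add: x_def p algebra_simps diff_divide_distrib[symmetric])
    finally have "(x p has_real_derivative (K * (force t a - force t b) - l * K) / m) (at t)" .
    moreover have "K * (force t a - force t b) \<le> K * 2"
      using abs_force_le[of t a] abs_force_le[of t b] K_pos by (intro mult_left_mono) auto
    moreover have "K * 2 < l * K" using K_pos \<open>l > 2\<close> by simp
    ultimately show "\<exists>d<0. (x p has_real_derivative d) (at t)"
      using m_pos by (intro exI[of _ "(K * (force t a - force t b) - l * K) / m"])
        (simp add: divide_neg_pos)
  qed
  then show ?thesis by (simp add: x_def)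
qed

section \<open>Confinement of the phases\<close>

text \<open>Sum-to-product pulls out a factor independent of \<open>k\<close>; the sign of the
  difference is then settled once every phase lies within \<open>pi / 2\<close> of the midpoint of
  the pair.\<close>

lemma force_difference:
  "force t i - force t j =
    - 2 * sin ((\<theta> i t - \<theta> j t) / 2) * (\<Sum>k\<in>UNIV. cos (\<theta> k t - (\<theta> i t + \<theta> j t) / 2)) / real CARD('n)"
proof -
  have "sin (\<theta> k t - \<theta> i t) - sin (\<theta> k t - \<theta> j t) =
      - 2 * sin ((\<theta> i t - \<theta> j t) / 2) * cos (\<theta> k t - (\<theta> i t + \<theta> j t) / 2)" for k
  proof -
    have "(\<theta> k t - \<theta> i t - (\<theta> k t - \<theta> j t)) / 2 = - ((\<theta> i t - \<theta> j t) / 2)"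
      "(\<theta> k t - \<theta> i t + (\<theta> k t - \<theta> j t)) / 2 = \<theta> k t - (\<theta> i t + \<theta> j t) / 2"
      by (simp_all add: field_simps)
    then show ?thesis unfolding sin_diff_sin by (simp only: sin_minus)
  qed
  then show ?thesis
    unfolding force_def diff_divide_distrib[symmetric] sum_subtractf[symmetric] sum_distrib_left
    by simp
qed

lemma phase_confinement:
  assumes "0 < d" "0 < e" "d + 4 * e < pi"
    and v: "\<And>i j t. t \<ge> 0 \<Longrightarrow> m * (v i t - v j t) < e"
    and init: "\<And>i j. \<theta> i 0 - \<theta> j 0 \<le> d"
    and "t \<ge> 0"
  shows "\<theta> i t - \<theta> j t < d + 2 * e"
proof -
  define y where "y = (\<lambda>(i, j) t. \<theta> i t - \<theta> j t + m * (v i t - v j t))"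
  have "y (i, j) t < d + e"
  proof (rule barrier_finite_family[OF _ _ _ \<open>t \<ge> 0\<close>])
    fix p show "continuous_on {0..} (y p)"
      by (cases p) (auto simp: y_def intro!: continuous_intros continuous_velocity continuous_phase)
    show "y p 0 < d + e"
      using init[of "fst p" "snd p"] v[of 0 "fst p" "snd p"] by (cases p) (simp add: y_def)
    fix t :: real assume "t > 0" and eq: "y p t = d + e" and le: "\<And>q. y q t \<le> d + e"
    obtain a b where p: "p = (a, b)" by (cases p)
    have "(y p has_real_derivative v a t - v b t + m *
        ((\<omega> + K * force t a - v a t) / m - (\<omega> + K * force t b - v b t) / m)) (at t)"
      unfolding y_def p prod.case
      by (intro DERIV_add DERIV_cmult DERIV_diff deriv_velocity_force deriv_phase \<open>t > 0\<close>)
    \<comment> \<open>The velocities cancel; this is the reason for the weight \<open>m\<close> in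
      \<open>y\<close>.\<close>
    moreover have "v a t - v b t + m *
        ((\<omega> + K * force t a - v a t) / m - (\<omega> + K * force t b - v b t) / m)
        = K * (force t a - force t b)"
      using m_pos by (simp add: field_simps)
    ultimately have deriv: "(y p has_real_derivative K * (force t a - force t b)) (at t)" by simp
    have vt: "m * v k t - m * v l t < e" for k l
      using v[of t k l] \<open>t > 0\<close> by (simp add: right_diff_distrib)
    have ab: "\<theta> a t - \<theta> b t + (m * v a t - m * v b t) = d + e"
      using eq by (simp add: y_def p right_diff_distrib)
    have lt: "d < \<theta> a t - \<theta> b t" "\<theta> a t - \<theta> b t < d + 2 * e"
      using ab vt[of a b] vt[of b a] by auto
    \<comment> \<open>The pair \<open>(a, b)\<close> is extremal for \<open>y\<close>, so
      \<open>\<theta> k t\<close> overshoots the interval from \<open>\<theta> b t\<close> to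
      \<open>\<theta> a t\<close> by less than \<open>e\<close>. Its distance from the midpoint is
      below \<open>(d + 2 * e) / 2 + e\<close>, which is less than \<open>pi / 2\<close> because
      \<open>d + 4 * e < pi\<close>.\<close>
    have "0 < cos (\<theta> k t - (\<theta> a t + \<theta> b t) / 2)" for k
    proof -
      have "\<theta> k t - \<theta> b t + (m * v k t - m * v b t) \<le> d + e"
        "\<theta> a t - \<theta> k t + (m * v a t - m * v k t) \<le> d + e"
        using le[of "(k, b)"] le[of "(a, k)"] by (simp_all add: y_def right_diff_distrib)
      then have "\<theta> k t - \<theta> a t < e" "\<theta> b t - \<theta> k t < e"
        using ab vt[of a k] vt[of k b] by linarith+
      then show ?thesis using lt assms(3) by (intro cos_gt_zero_pi) (simp_all add: field_simps)
    qed
    then have "0 < (\<Sum>k\<in>UNIV. cos (\<theta> k t - (\<theta> a t + \<theta> b t) / 2))" by (intro sum_pos) auto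
    moreover have "0 < sin ((\<theta> a t - \<theta> b t) / 2)"
      using lt assms(1-3) by (intro sin_gt_zero) auto
    ultimately have "force t a - force t b < 0"
      unfolding force_difference by (simp add: zero_less_mult_iff)
    then show "\<exists>d<0. (y p has_real_derivative d) (at t)"
      using deriv K_pos by (intro exI[of _ "K * (force t a - force t b)"]) (simp add: mult_less_0_iff)
  qed
  then show ?thesis using v[OF \<open>t \<ge> 0\<close>, of j i] by (simp add: y_def algebra_simps)
qed

section \<open>An energy over pairs and its dissipation\<close>

text \<open>By antisymmetry of the sine the forces add up to zero, so the left side is
  \<open>2 * N\<close> times the sum of \<open>x i * force t i\<close>; antisymmetry also turns the
  sine sum into the negative of this.\<close>

lemma sum_pairs_force:
  "(\<Sum>i\<in>UNIV. \<Sum>j\<in>UNIV. (x i - x j) * (force t i - force t j)) =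
   - (\<Sum>i\<in>UNIV. \<Sum>j\<in>UNIV. (x i - x j) * sin (\<theta> i t - \<theta> j t))" (is "?L = - ?R")
proof -
  define n where "n = real CARD('n)"
  have "n > 0" by (simp add: n_def)
  define A where "A = (\<Sum>i\<in>UNIV. \<Sum>k\<in>UNIV. x i * sin (\<theta> k t - \<theta> i t))"
  have neg: "sin (\<theta> k t - \<theta> i t) = - sin (\<theta> i t - \<theta> k t)" for i k
    by (subst sin_minus[symmetric]) simp
  have xf: "n * (\<Sum>i\<in>UNIV. x i * force t i) = A"
    by (simp add: A_def force_def n_def sum_divide_distrib[symmetric] sum_distrib_left[symmetric])
  have swap: "(\<Sum>i\<in>UNIV. \<Sum>k\<in>UNIV. sin (\<theta> k t - \<theta> i t))
      = - (\<Sum>i\<in>UNIV. \<Sum>k\<in>UNIV. sin (\<theta> k t - \<theta> i t))"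
    by (subst sum.swap) (subst neg, simp add: sum_negf)
  have f: "(\<Sum>i\<in>UNIV. force t i) = 0"
    using swap by (simp add: force_def sum_divide_distrib[symmetric])
  have "?L = (\<Sum>i\<in>UNIV. \<Sum>j\<in>(UNIV :: 'n set). x i * force t i)
      + (\<Sum>i\<in>(UNIV :: 'n set). \<Sum>j\<in>UNIV. x j * force t j)
      - (\<Sum>i\<in>UNIV. \<Sum>j\<in>UNIV. x i * force t j) - (\<Sum>i\<in>UNIV. \<Sum>j\<in>UNIV. x j * force t i)"
    by (simp add: algebra_simps sum.distrib sum_subtractf)
  also have "\<dots> = n * (\<Sum>i\<in>UNIV. x i * force t i) + n * (\<Sum>i\<in>UNIV. x i * force t i)"
    using f by (simp add: n_def sum_distrib_left[symmetric] sum_distrib_right[symmetric])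
  finally have L: "?L = 2 * A" using xf by simp
  have "?R = (\<Sum>i\<in>UNIV. \<Sum>j\<in>UNIV. x i * sin (\<theta> i t - \<theta> j t))
      - (\<Sum>i\<in>UNIV. \<Sum>j\<in>UNIV. x j * sin (\<theta> i t - \<theta> j t))"
    by (simp add: left_diff_distrib sum_subtractf)
  moreover have "(\<Sum>i\<in>UNIV. \<Sum>j\<in>UNIV. x i * sin (\<theta> i t - \<theta> j t)) = - A"
    unfolding A_def by (subst (2) neg) (simp add: sum_negf)
  moreover have "(\<Sum>i\<in>UNIV. \<Sum>j\<in>UNIV. x j * sin (\<theta> i t - \<theta> j t)) = A"
    unfolding A_def by (subst sum.swap) simp
  ultimately show ?thesis using L by simp
qed

text \<open>The cosine potential balances the work of the forces on
  \<open>m\<^sup>2 * w\<^sup>2\<close> after summation over pairs. The cross term brings in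
  dissipation in \<open>u\<close>, and \<open>u\<^sup>2 / 2\<close> cancels the product
  \<open>u * w\<close> that it leaves behind.\<close>

definition pair_energy :: "real \<Rightarrow> real \<Rightarrow> real" where
  "pair_energy u w = m\<^sup>2 * w\<^sup>2 + m * (u * w) + u\<^sup>2 / 2 + 2 * m * K * (1 - cos u)"

definition energy :: "real \<Rightarrow> real" where
  "energy t = (\<Sum>i\<in>UNIV. \<Sum>j\<in>UNIV. pair_energy (\<theta> i t - \<theta> j t) (v i t - v j t))"

lemma pair_energy_ge: "u\<^sup>2 / 4 \<le> pair_energy u w"
proof -
  have "pair_energy u w = (m * w + u / 2)\<^sup>2 + u\<^sup>2 / 4 + 2 * m * K * (1 - cos u)"
    by (simp add: pair_energy_def power2_eq_square field_simps)
  moreover have "0 \<le> 2 * m * K * (1 - cos u)" using m_pos K_pos by simp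
  ultimately show ?thesis by simp
qed

lemma pair_energy_le: "pair_energy u w \<le> 3 / 2 * m\<^sup>2 * w\<^sup>2 + (1 + m * K) * u\<^sup>2"
proof -
  have "2 * m * K * (1 - cos u) \<le> 2 * m * K * (u\<^sup>2 / 2)"
    using m_pos K_pos one_minus_cos_le by (intro mult_left_mono) auto
  moreover have "m * (u * w) \<le> m\<^sup>2 * w\<^sup>2 / 2 + u\<^sup>2 / 2"
    using zero_le_power2[of "m * w - u"] by (simp add: power2_eq_square algebra_simps)
  ultimately show ?thesis by (simp add: pair_energy_def algebra_simps)
qed

text \<open>The derivative \<open>w'\<close> is kept inside products \<open>m * w'\<close>, so that
  the equation of motion can be substituted by rewriting.\<close>

lemma deriv_pair_energy:
  assumes "(u has_real_derivative u') (at t)" "(w has_real_derivative w') (at t)"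
  shows "((\<lambda>t. pair_energy (u t) (w t)) has_real_derivative
    2 * m * w t * (m * w') + (m * (w t * u') + u t * (m * w')) + u t * u'
    + 2 * m * K * (u' * sin (u t))) (at t)"
  unfolding pair_energy_def
  by (auto intro!: derivative_eq_intros assms simp: power2_eq_square algebra_simps)

text \<open>The contribution \<open>D i j\<close> of a single pair has no sign. After summation,
  \<open>sum_pairs_force\<close> for the velocities removes the terms with \<open>2 * m * K\<close>,
  and for the phases it turns \<open>K * (u * f)\<close> into
  \<open>- K * (u * sin u)\<close>.\<close>

lemma deriv_energy:
  assumes "t > 0"
  shows "(energy has_real_derivative - (\<Sum>i\<in>UNIV. \<Sum>j\<in>UNIV.
      m * (v i t - v j t)\<^sup>2 + K * ((\<theta> i t - \<theta> j t) * sin (\<theta> i t - \<theta> j t)))) (at t)"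
proof -
  define u w f where "u = (\<lambda>i j. \<theta> i t - \<theta> j t)" and "w = (\<lambda>i j. v i t - v j t)"
    and "f = (\<lambda>i j. force t i - force t j)"
  define D where "D = (\<lambda>i j. 2 * m * K * (w i j * f i j) - m * (w i j)\<^sup>2
      + K * (u i j * f i j) + 2 * m * K * (w i j * sin (u i j)))"
  have pair: "((\<lambda>t. pair_energy (\<theta> i t - \<theta> j t) (v i t - v j t)) has_real_derivative D i j) (at t)"
    for i j
  proof -
    define a where "a = (K * f i j - w i j) / m"
    have ma: "m * a = K * f i j - w i j" using m_pos by (simp add: a_def)
    have du: "((\<lambda>t. \<theta> i t - \<theta> j t) has_real_derivative w i j) (at t)"
      unfolding w_def by (intro DERIV_diff deriv_phase assms)
    have "((\<lambda>t. v i t - v j t) has_real_derivative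
        (\<omega> + K * force t i - v i t) / m - (\<omega> + K * force t j - v j t) / m) (at t)"
      by (intro DERIV_diff deriv_velocity_force assms)
    also have "(\<omega> + K * force t i - v i t) / m - (\<omega> + K * force t j - v j t) / m = a"
      by (simp add: a_def f_def w_def diff_divide_distrib[symmetric] right_diff_distrib)
    finally have dw: "((\<lambda>t. v i t - v j t) has_real_derivative a) (at t)" .
    have "((\<lambda>t. pair_energy (\<theta> i t - \<theta> j t) (v i t - v j t)) has_real_derivative
        2 * m * w i j * (m * a) + (m * (w i j * w i j) + u i j * (m * a)) + u i j * w i j
        + 2 * m * K * (w i j * sin (u i j))) (at t)"
      using deriv_pair_energy[OF du dw] by (simp only: u_def w_def)
    also have "2 * m * w i j * (m * a) + (m * (w i j * w i j) + u i j * (m * a)) + u i j * w i j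
        + 2 * m * K * (w i j * sin (u i j)) = D i j"
      unfolding ma D_def by (simp add: power2_eq_square algebra_simps)
    finally show ?thesis .
  qed
  have "(energy has_real_derivative (\<Sum>i\<in>UNIV. \<Sum>j\<in>UNIV. D i j)) (at t)"
    unfolding energy_def by (intro DERIV_sum pair)
  moreover have "(\<Sum>i\<in>UNIV. \<Sum>j\<in>UNIV. D i j) =
      - (\<Sum>i\<in>UNIV. \<Sum>j\<in>UNIV. m * (w i j)\<^sup>2 + K * (u i j * sin (u i j)))"
    using sum_pairs_force[of "\<lambda>i. v i t" t] sum_pairs_force[of "\<lambda>i. \<theta> i t" t]
    unfolding D_def
    by (simp add: sum.distrib sum_subtractf sum_distrib_left[symmetric] u_def w_def f_def)
  ultimately show ?thesis by (simp add: u_def w_def)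
qed

section \<open>Exponential decay of phase differences\<close>

lemma synchronization:
  assumes "B < pi" and B: "\<And>i j t. t \<ge> 0 \<Longrightarrow> \<bar>\<theta> i t - \<theta> j t\<bar> \<le> B"
  shows "((\<lambda>t. \<theta> i t - \<theta> j t) \<longlongrightarrow> 0) at_top"
proof -
  define c where "c = (cos (B / 2))\<^sup>2"
  have "0 \<le> B" using B[of 0 i i] by simp
  then have "cos (B / 2) > 0" using \<open>B < pi\<close> by (intro cos_gt_zero_pi) auto
  then have "c > 0" by (simp add: c_def)
  \<comment> \<open>The two entries compare the coefficients of \<open>w\<^sup>2\<close> and
    \<open>u\<^sup>2\<close> in \<open>pair_energy_le\<close> with those of the dissipation.\<close>
  define \<kappa> where "\<kappa> = min (2 / (3 * m)) (K * c / (1 + m * K))"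
  have "\<kappa> > 0" using m_pos K_pos \<open>c > 0\<close> by (simp add: \<kappa>_def add_pos_pos)
  have \<kappa>: "\<kappa> * (3 / 2 * m\<^sup>2) \<le> m" "\<kappa> * (1 + m * K) \<le> K * c"
  proof -
    have "\<kappa> * (3 / 2 * m\<^sup>2) \<le> 2 / (3 * m) * (3 / 2 * m\<^sup>2)"
      by (intro mult_right_mono) (auto simp: \<kappa>_def)
    then show "\<kappa> * (3 / 2 * m\<^sup>2) \<le> m" using m_pos by (simp add: power2_eq_square)
    have "0 < 1 + m * K" using m_pos K_pos by (simp add: add_pos_pos)
    then have "\<kappa> * (1 + m * K) \<le> K * c / (1 + m * K) * (1 + m * K)"
      by (intro mult_right_mono) (auto simp: \<kappa>_def)
    then show "\<kappa> * (1 + m * K) \<le> K * c" using \<open>0 < 1 + m * K\<close> by simp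
  qed
  have pair: "\<kappa> * pair_energy u w \<le> m * w\<^sup>2 + K * (u * sin u)" if "\<bar>u\<bar> \<le> B" for u w
  proof -
    have "\<kappa> * pair_energy u w \<le> \<kappa> * (3 / 2 * m\<^sup>2 * w\<^sup>2 + (1 + m * K) * u\<^sup>2)"
      using \<open>\<kappa> > 0\<close> pair_energy_le by (intro mult_left_mono) auto
    also have "\<dots> = \<kappa> * (3 / 2 * m\<^sup>2) * w\<^sup>2 + \<kappa> * (1 + m * K) * u\<^sup>2"
      by (simp add: algebra_simps)
    also have "\<dots> \<le> m * w\<^sup>2 + K * c * u\<^sup>2"
      by (intro add_mono mult_right_mono \<kappa>) auto
    also have "\<dots> \<le> m * w\<^sup>2 + K * (u * sin u)"
      using mult_sin_ge_square[of u B] that \<open>B < pi\<close> K_pos by (simp add: c_def mult.assoc)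
    finally show ?thesis .
  qed
  have decay: "exp (\<kappa> * t) * energy t \<le> energy 0" if "t > 0" for t
  proof -
    have "(\<lambda>t. exp (\<kappa> * t) * energy t) t \<le> (\<lambda>t. exp (\<kappa> * t) * energy t) 0"
    proof (rule DERIV_nonpos_imp_decreasing_open[OF less_imp_le[OF \<open>t > 0\<close>]])
      have sub: "continuous_on {0..t} (\<theta> i)" "continuous_on {0..t} (v i)" for i
        using continuous_on_subset[OF continuous_phase] continuous_on_subset[OF continuous_velocity]
        by auto
      show "continuous_on {0..t} (\<lambda>t. exp (\<kappa> * t) * energy t)"
        unfolding energy_def pair_energy_def by (intro continuous_intros sub) auto
      fix s assume s: "0 < s" "s < t"
      define d where "d = (\<Sum>i\<in>UNIV. \<Sum>j\<in>UNIV.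
        m * (v i s - v j s)\<^sup>2 + K * ((\<theta> i s - \<theta> j s) * sin (\<theta> i s - \<theta> j s)))"
      have "((\<lambda>t. exp (\<kappa> * t) * energy t) has_real_derivative exp (\<kappa> * s) * (\<kappa> * energy s - d)) (at s)"
        using deriv_energy[OF s(1)]
        by (auto intro!: derivative_eq_intros simp: d_def algebra_simps)
      moreover have "\<kappa> * energy s \<le> d"
        unfolding energy_def d_def sum_distrib_left using s by (intro sum_mono pair B) auto
      ultimately show "\<exists>z. ((\<lambda>t. exp (\<kappa> * t) * energy t) has_real_derivative z) (at s) \<and> z \<le> 0"
        by (intro exI[of _ "exp (\<kappa> * s) * (\<kappa> * energy s - d)"]) (simp add: mult_le_0_iff)
    qed
    then show ?thesis by simp
  qed
  have bound: "(\<theta> i t - \<theta> j t)\<^sup>2 \<le> 4 * energy 0 * exp (- \<kappa> * t)" if "t > 0" for t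
  proof -
    have nonneg: "0 \<le> pair_energy u w" for u w
      using pair_energy_ge[of u w] zero_le_power2[of u] by linarith
    have "(\<theta> i t - \<theta> j t)\<^sup>2 / 4 \<le> pair_energy (\<theta> i t - \<theta> j t) (v i t - v j t)"
      by (rule pair_energy_ge)
    also have "\<dots> \<le> (\<Sum>j\<in>UNIV. pair_energy (\<theta> i t - \<theta> j t) (v i t - v j t))"
      using nonneg by (intro member_le_sum[where i = j]) auto
    also have "\<dots> \<le> energy t"
      unfolding energy_def using nonneg
      by (intro member_le_sum[where i = i and f = "\<lambda>i. \<Sum>j\<in>UNIV. pair_energy (\<theta> i t - \<theta> j t) (v i t - v j t)"])
        (auto intro: sum_nonneg)
    finally have "(\<theta> i t - \<theta> j t)\<^sup>2 \<le> 4 * energy t" by simp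
    moreover have "energy t \<le> energy 0 * exp (- \<kappa> * t)"
      using decay[OF that] by (simp add: exp_minus field_simps)
    ultimately show ?thesis by simp
  qed
  have "((\<lambda>t. 4 * energy 0 * exp (- \<kappa> * t)) \<longlongrightarrow> 4 * energy 0 * 0) at_top"
    using \<open>\<kappa> > 0\<close>
    by (intro tendsto_mult tendsto_const filterlim_compose[OF exp_at_bot]
        filterlim_tendsto_neg_mult_at_bot[OF tendsto_const _ filterlim_ident]) auto
  then have lim: "((\<lambda>t. 4 * energy 0 * exp (- \<kappa> * t)) \<longlongrightarrow> 0) at_top"
    by (simp only: mult_zero_right)
  have upper: "\<forall>\<^sub>F t in at_top. (\<theta> i t - \<theta> j t)\<^sup>2 \<le> 4 * energy 0 * exp (- \<kappa> * t)"
    by (rule eventually_mono[OF eventually_gt_at_top[of 0] bound])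
  have lower: "\<forall>\<^sub>F t in at_top. 0 \<le> (\<theta> i t - \<theta> j t)\<^sup>2" by simp
  have "((\<lambda>t. (\<theta> i t - \<theta> j t)\<^sup>2) \<longlongrightarrow> 0) at_top"
    by (rule tendsto_sandwich[OF lower upper tendsto_const lim])
  then show ?thesis by (simp add: power_tendsto_0_iff)
qed

end

section \<open>From the vector solution and its smallness condition to the scalar system\<close>

theorem theorem1p2:
  fixes m K \<alpha> \<beta> \<mu> lam :: real
    and \<Omega> :: "real ^ 'n"
    and \<Theta> V :: "real \<Rightarrow> real ^ 'n"
  assumes "m > 0" and "K > 0"
    and "0 < \<beta>" and "\<beta> < \<alpha>" and "\<alpha> < pi" and "2 * \<beta> + \<alpha> < pi"
    and "\<mu> = sin (\<alpha> / 2 - \<beta> / 4) * cos (\<alpha> / 2 + 5 / 8 * \<beta>)"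
    and "lam > 0" and "lam > \<mu> + 2"
    and "m * K \<le> \<beta> / (4 * (lam + \<mu> + 2) * ln ((lam + 2 * \<mu> + 2) / \<mu>))"
    and "spread \<Omega> = 0"
    and "inertial_kuramoto_solution m K \<Omega> \<Theta> V"
    and "spread (\<Theta> 0) \<le> pi - \<alpha> - \<beta>"
    and "spread (V 0) < lam * K"
  shows "\<forall>i j. ((\<lambda>t. \<Theta> t $ i - \<Theta> t $ j) \<longlongrightarrow> 0) at_top"
proof -
  \<comment> \<open>Both angles lie strictly between 0 and \<open>pi / 2\<close>; for the second
    this follows from \<open>2 * \<beta> + \<alpha> < pi\<close>.\<close>
  have "\<mu> > 0"
    unfolding assms(7) using assms(3-6) by (intro mult_pos_pos sin_gt_zero cos_gt_zero_pi) auto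
  define e where "e = m * (lam * K)"
  have "e > 0" using assms(1,2,8) by (simp add: e_def)
  \<comment> \<open>The argument of the logarithm is \<open>2 + (lam + 2) / \<mu>\<close>, hence at
    least 3 and so at least \<open>exp 1\<close>. The denominator in the smallness condition is
    therefore at least \<open>4 * lam\<close>.\<close>
  have "4 * e \<le> \<beta>"
  proof -
    have "exp 1 \<le> (3::real)" by (rule exp_le)
    also have "3 \<le> (lam + 2 * \<mu> + 2) / \<mu>" using \<open>\<mu> > 0\<close> assms(9) by (simp add: field_simps)
    finally have ln: "1 \<le> ln ((lam + 2 * \<mu> + 2) / \<mu>)"
      using \<open>\<mu> > 0\<close> assms(8) by (subst ln_ge_iff) auto
    have le: "4 * lam \<le> 4 * (lam + \<mu> + 2) * ln ((lam + 2 * \<mu> + 2) / \<mu>)"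
      using mult_mono[OF _ ln, of "4 * lam" "4 * (lam + \<mu> + 2)"] \<open>\<mu> > 0\<close> assms(8) by simp
    have "m * K \<le> \<beta> / (4 * lam)"
      using le assms(3,8,10) by (intro order_trans[OF assms(10)] divide_left_mono) auto
    then show ?thesis using assms(8) by (simp add: e_def field_simps)
  qed
  \<comment> \<open>Here \<open>undefined\<close> is just some fixed index; zero spread makes its
    entry the common frequency.\<close>
  have \<Omega>: "\<Omega> $ i = \<Omega> $ undefined" for i
    using spread_ge[of \<Omega> i undefined] spread_ge[of \<Omega> undefined i] assms(11) by simp
  note sol = assms(12)[unfolded inertial_kuramoto_solution_def]
  have deriv: "(\<Theta> has_vector_derivative V t) (at t within {0..})" if "t \<ge> 0" for t
    using sol that by blast
  interpret identical_inertial_oscillators m K "\<Omega> $ undefined" "\<lambda>i t. \<Theta> t $ i" "\<lambda>i t. V t $ i"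
  proof
    show "m > 0" "K > 0" by fact+
    fix i
    have "continuous_on {0..} \<Theta>"
      using deriv by (auto simp: continuous_on_eq_continuous_within intro: has_vector_derivative_continuous)
    then show "continuous_on {0..} (\<lambda>t. \<Theta> t $ i)" by (intro continuous_intros)
    show "continuous_on {0..} (\<lambda>t. V t $ i)" using sol by (intro continuous_intros) blast
    fix t :: real assume "t > 0"
    \<comment> \<open>At an interior time the one-sided derivative is two-sided.\<close>
    have "at t within {0..} = at t"
      using \<open>t > 0\<close> by (intro at_within_interior) (auto simp: interior_real_atLeast)
    then have "(\<Theta> has_vector_derivative V t) (at t)" using deriv[of t] \<open>t > 0\<close> by simp
    then show "((\<lambda>t. \<Theta> t $ i) has_real_derivative V t $ i) (at t)"
      unfolding has_real_derivative_iff_has_vector_derivative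
      by (rule bounded_linear.has_vector_derivative[OF bounded_linear_vec_nth])
    obtain A where A: "(V has_vector_derivative A) (at t)"
      "m * A $ i + V t $ i =
        \<Omega> $ i + K / real CARD('n) * (\<Sum>j\<in>UNIV. sin (\<Theta> t $ j - \<Theta> t $ i))"
      using sol \<open>t > 0\<close> by blast
    have "A $ i = (\<Omega> $ undefined + K / real CARD('n) * (\<Sum>k\<in>UNIV. sin (\<Theta> t $ k - \<Theta> t $ i)) - V t $ i) / m"
      using A(2) \<Omega>[of i] \<open>m > 0\<close> by (simp add: eq_divide_eq mult.commute)
    moreover have "((\<lambda>t. V t $ i) has_real_derivative A $ i) (at t)"
      unfolding has_real_derivative_iff_has_vector_derivative
      by (rule bounded_linear.has_vector_derivative[OF bounded_linear_vec_nth A(1)])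
    ultimately show "((\<lambda>t. V t $ i) has_real_derivative
      (\<Omega> $ undefined + K / real CARD('n) * (\<Sum>k\<in>UNIV. sin (\<Theta> t $ k - \<Theta> t $ i)) - V t $ i) / m) (at t)"
      by simp
  qed
  have v: "m * (V t $ i - V t $ j) < e" if "t \<ge> 0" for i j t
  proof -
    have init: "V 0 $ i - V 0 $ j < lam * K" for i j
      using spread_ge[of "V 0" i j] assms(14) by linarith
    have "lam > 2" using assms(9) \<open>\<mu> > 0\<close> by simp
    then have "V t $ i - V t $ j < lam * K" using init that by (rule velocity_difference_bound)
    then show ?thesis using \<open>m > 0\<close> by (simp add: e_def)
  qed
  \<comment> \<open>With \<open>d = pi - \<alpha> - \<beta>\<close>, the bound
    \<open>4 * e \<le> \<beta>\<close> gives \<open>d + 4 * e \<le> pi - \<alpha> < pi\<close>, and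
    it also puts \<open>d + 2 * e\<close> below \<open>pi - \<alpha>\<close>.\<close>
  have conf: "\<Theta> t $ i - \<Theta> t $ j < pi - \<alpha> - \<beta> + 2 * e" if "t \<ge> 0" for i j t
  proof (rule phase_confinement[OF _ \<open>e > 0\<close> _ v _ that])
    show "\<Theta> 0 $ i - \<Theta> 0 $ j \<le> pi - \<alpha> - \<beta>" for i j
      using spread_ge assms(13) by (rule order_trans)
  qed (use assms(3-6) \<open>4 * e \<le> \<beta>\<close> in auto)
  have "\<bar>\<Theta> t $ i - \<Theta> t $ j\<bar> \<le> pi - \<alpha>" if "t \<ge> 0" for i j t
    using conf[OF that, of i j] conf[OF that, of j i] \<open>e > 0\<close> \<open>4 * e \<le> \<beta>\<close> by auto
  then show ?thesis using synchronization[of "pi - \<alpha>"] assms(3,4) by auto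
qed

end
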